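(* With the problem data, polyhedra and projection as described in the context, the projection of the linear relaxation of the time-block formulation is strictly contained in the linear relaxation of the original formulation: $$\mathrm{proj}_{y,s}\big(\tilde P^{y\text{-}\lambda}_{\mathrm{LP}}\big)\subsetneq\tilde P^{y\text{-}s}_{\mathrm{LP}}.$$
   Context: Data. $\mathcal N=\{1,\dots,N\}$ is the set of charging ports; $\mathcal T=\{1,\dots,T\}$ the set of time periods; $\mathcal L=\{1,\dots,L\}$ the set of demand windows; $\mathcal B$ is a finite set of batteries partitioned into pairwise disjoint sets $\mathcal B_\ell$, $\ell\in\mathcal L$. For $\ell\in\mathcal L$, $n_\ell\in\mathcal T$ and $\mathcal T_\ell=\{1,\dots,n_\ell\}$, with $n_L=T$. Further data: prices $c_t\ge 0$ ($t\in\mathcal T$), $\gamma\in\mathbb Z_+$, $\beta\in(0,1)$, and real multipliers $\mu_{jkt}$ for $\ell\in\mathcal L$, $j\in\mathcal B_\ell$, $k\in\mathcal N$, $t\in\mathcal T_\ell$. Put $\bar c_{jkt}:=(1-\beta)c_t-\mu_{jkt}$. Variables. $s_{jkt}$ is indexed by $\ell\in\mathcal L$, $j\in\mathcal B_\ell$, $k\in\mathcal N$, $t\in\mathcal T_\ell$; for $j\in\mathcal B_\ell$ and $t>n_\ell$ set $s_{jkt}:=0$. $y_{kt}$ is indexed by $k\in\mathcal N$, $t\in\mathcal T\setminus\{T\}$. Linear relaxation of the original formulation. $\tilde P^{y\text{-}s}_{\mathrm{LP}}$ is the set of real $(y,s)$ with all $y_{kt},s_{jkt}\in[0,1]$ such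 that (i) $y_{kt}\ge\sum_{j\in\mathcal B}s_{jk,t+1}-\sum_{j\in\mathcal B}s_{jkt}$ for $k\in\mathcal N$, $t\in\mathcal T\setminus\{T\}$; (ii) $y_{kt}\ge s_{jkt}-s_{jk,t+1}$ for $\ell\in\mathcal L$, $j\in\mathcal B_\ell$, $k\in\mathcal N$, $t\in\mathcal T_\ell\setminus\{T\}$; (iii) $\sum_{k\in\mathcal N}y_{kt}\le\gamma$ for $t\in\mathcal T\setminus\{T\}$; (iv) $\sum_{j\in\mathcal B}s_{jkt}\le 1$ for $k\in\mathcal N$, $t\in\mathcal T$. Linear relaxation of the time-block formulation. A time block is a pair $(t_1,t_2)$ of integers with $0\le t_1<t_2\le T$. For $k\in\mathcal N$, $\mathcal T^k_<$ is the set of time blocks with $\min\{\sum_{t=t_1+1}^{t_2}\bar c_{jkt}\mid \ell\in\mathcal L,\ j\in\mathcal B_\ell,\ t_2\le n_\ell\}<0$. $\tilde P^{y\text{-}\lambda}_{\mathrm{LP}}$ is the set of real $(y,\lambda)$, with $y_{kt}\in[0,1]$ ($k\in\mathcal N$, $t\in\mathcal T\setminus\{T\}$) and $\lambda_{kt_1t_2}\in[0,1]$ ($k\in\mathcal N$, $(t_1,t_2)\in\mathcal T^k_<$), such that (a) $\lambda_{kt_1t_2}+\lambda_{kt_1't_2'}\le 1$ for $k\in\mathcal N$ and distinct $(t_1,t_2),(t_1',t_2')\in\mathcal T^k_<$ with $t_1'<t_2$ and $t_2'>t_1$; (b) $y_{kt_1}\ge\sum_{t=t_1+1}^{T}\lambda_{kt_1t}$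 for $k\in\mathcal N$, $t_1\in\{1,\dots,T-1\}$; (c) $y_{kt_2}\ge\sum_{t=0}^{t_2-1}\lambda_{ktt_2}$ for $k\in\mathcal N$, $t_2\in\{1,\dots,T-1\}$; (d) $\sum_{k\in\mathcal N}y_{kt}\le\gamma$ for $t\in\mathcal T\setminus\{T\}$; where in (b), (c) only those $\lambda$ whose block lies in $\mathcal T^k_<$ appear. Projection. For $\lambda$, let $M(\lambda)$ be the set of minimizers of $\sum_{\ell\in\mathcal L}\sum_{t\in\mathcal T_\ell}\sum_{j\in\mathcal B_\ell}\sum_{k\in\mathcal N}\bar c_{jkt}s_{jkt}$ over all $s$ with entries in $[0,1]$ satisfying $$\lambda_{kt_1t_2}\ge\frac{1}{t_2-t_1}\sum_{j\in\mathcal B}\sum_{t=t_1+1}^{t_2}s_{jkt}\qquad\text{for all }k\in\mathcal N,\ (t_1,t_2)\in\mathcal T^k_< .$$ Then $\mathrm{proj}_{y,s}(\tilde P^{y\text{-}\lambda}_{\mathrm{LP}}):=\{(y,s)\mid \exists\,\lambda:\ (y,\lambda)\in\tilde P^{y\text{-}\lambda}_{\mathrm{LP}},\ s\in M(\lambda)\}$.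
   Formalization: Fails for some data (e.g. N=T=L=1, two batteries, zero reduced costs); proved assuming T ≥ 2, B_L nonempty, and that for every port k and period t the smallest reduced cost min c̄_{jkt} over batteries whose window contains t is nonzero. *)

theory Defs
  imports Complex_Main "HOL-Library.Disjoint_Sets"
begin

text \<open>
  A point of a polyhedron is a total function of its indices. Every feasible point is required to
  be 0 outside the paper's index range, so that each point has exactly one representation and
  (strict) inclusions between the sets below are inclusions between sets of vectors. For \<open>s\<close> this
  includes the convention \<open>s j k t = 0\<close> for \<open>j \<in> B l\<close> and \<open>t > n l\<close>.
\<close>

locale battery_charging =
  fixes N T L :: nat
    and B :: "nat \<Rightarrow> 'b set"
    and n :: "nat \<Rightarrow> nat"
    and c :: "nat \<Rightarrow> real"
    and \<gamma> :: nat
    and \<beta> :: real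
    and \<mu> :: "'b \<Rightarrow> nat \<Rightarrow> nat \<Rightarrow> real"
  assumes N_pos: "1 \<le> N" and T_pos: "1 \<le> T" and L_pos: "1 \<le> L"
    and finite_B: "l \<in> {1..L} \<Longrightarrow> finite (B l)"
    and disjoint_B: "disjoint_family_on B {1..L}"
    and n_range: "l \<in> {1..L} \<Longrightarrow> n l \<in> {1..T}"
    and n_last: "n L = T"
    and c_nonneg: "t \<in> {1..T} \<Longrightarrow> 0 \<le> c t"
    and \<beta>_range: "0 < \<beta>" "\<beta> < 1"
begin

definition batteries :: "'b set" where
  "batteries = (\<Union>l\<in>{1..L}. B l)"

definition cbar :: "'b \<Rightarrow> nat \<Rightarrow> nat \<Rightarrow> real" where
  "cbar j k t = (1 - \<beta>) * c t - \<mu> j k t"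

definition y_box :: "(nat \<Rightarrow> nat \<Rightarrow> real) set" where
  "y_box = {y. (\<forall>k\<in>{1..N}. \<forall>t\<in>{1..T} - {T}. y k t \<in> {0..1}) \<and>
               (\<forall>k t. \<not> (k \<in> {1..N} \<and> t \<in> {1..T} - {T}) \<longrightarrow> y k t = 0)}"

definition s_index :: "('b \<times> nat \<times> nat) set" where
  "s_index = {(j, k, t). \<exists>l\<in>{1..L}. j \<in> B l \<and> k \<in> {1..N} \<and> t \<in> {1..n l}}"

definition s_box :: "('b \<Rightarrow> nat \<Rightarrow> nat \<Rightarrow> real) set" where
  "s_box = {s. (\<forall>(j, k, t)\<in>s_index. s j k t \<in> {0..1}) \<and>
               (\<forall>j k t. (j, k, t) \<notin> s_index \<longrightarrow> s j k t = 0)}"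

definition P_ys :: "((nat \<Rightarrow> nat \<Rightarrow> real) \<times> ('b \<Rightarrow> nat \<Rightarrow> nat \<Rightarrow> real)) set" where
  "P_ys = {(y, s). y \<in> y_box \<and> s \<in> s_box \<and>
     (\<forall>k\<in>{1..N}. \<forall>t\<in>{1..T} - {T}.
        y k t \<ge> (\<Sum>j\<in>batteries. s j k (t + 1)) - (\<Sum>j\<in>batteries. s j k t)) \<and>
     (\<forall>l\<in>{1..L}. \<forall>j\<in>B l. \<forall>k\<in>{1..N}. \<forall>t\<in>{1..n l} - {T}.
        y k t \<ge> s j k t - s j k (t + 1)) \<and>
     (\<forall>t\<in>{1..T} - {T}. (\<Sum>k\<in>{1..N}. y k t) \<le> real \<gamma>) \<and>
     (\<forall>k\<in>{1..N}. \<forall>t\<in>{1..T}. (\<Sum>j\<in>batteries. s j k t) \<le> 1)}"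

definition block_costs :: "nat \<Rightarrow> nat \<Rightarrow> nat \<Rightarrow> real set" where
  "block_costs k t1 t2 =
     {(\<Sum>t\<in>{t1 + 1..t2}. cbar j k t) | l j. l \<in> {1..L} \<and> j \<in> B l \<and> t2 \<le> n l}"

text \<open>
  The set of costs is finite; it can be empty if some \<open>B l\<close> are. The minimum of the empty set
  counts as \<open>+\<infinity>\<close>, i.e. as not negative.
\<close>

definition neg_blocks :: "nat \<Rightarrow> (nat \<times> nat) set" where
  "neg_blocks k = {(t1, t2). t1 < t2 \<and> t2 \<le> T \<and>
     block_costs k t1 t2 \<noteq> {} \<and> Min (block_costs k t1 t2) < 0}"

definition lam_box :: "(nat \<Rightarrow> nat \<Rightarrow> nat \<Rightarrow> real) set" where
  "lam_box = {lam. (\<forall>k\<in>{1..N}. \<forall>(t1, t2)\<in>neg_blocks k. lam k t1 t2 \<in> {0..1}) \<and>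
     (\<forall>k t1 t2. \<not> (k \<in> {1..N} \<and> (t1, t2) \<in> neg_blocks k) \<longrightarrow> lam k t1 t2 = 0)}"

definition P_ylam :: "((nat \<Rightarrow> nat \<Rightarrow> real) \<times> (nat \<Rightarrow> nat \<Rightarrow> nat \<Rightarrow> real)) set" where
  "P_ylam = {(y, lam). y \<in> y_box \<and> lam \<in> lam_box \<and>
     (\<forall>k\<in>{1..N}. \<forall>(t1, t2)\<in>neg_blocks k. \<forall>(t1', t2')\<in>neg_blocks k.
        (t1, t2) \<noteq> (t1', t2') \<and> t1' < t2 \<and> t2' > t1 \<longrightarrow> lam k t1 t2 + lam k t1' t2' \<le> 1) \<and>
     (\<forall>k\<in>{1..N}. \<forall>t1\<in>{1..T} - {T}.
        y k t1 \<ge> (\<Sum>t | t \<in> {t1 + 1..T} \<and> (t1, t) \<in> neg_blocks k. lam k t1 t)) \<and>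
     (\<forall>k\<in>{1..N}. \<forall>t2\<in>{1..T} - {T}.
        y k t2 \<ge> (\<Sum>t | t \<in> {0..t2 - 1} \<and> (t, t2) \<in> neg_blocks k. lam k t t2)) \<and>
     (\<forall>t\<in>{1..T} - {T}. (\<Sum>k\<in>{1..N}. y k t) \<le> real \<gamma>)}"

definition s_cost :: "('b \<Rightarrow> nat \<Rightarrow> nat \<Rightarrow> real) \<Rightarrow> real" where
  "s_cost s = (\<Sum>l\<in>{1..L}. \<Sum>t\<in>{1..n l}. \<Sum>j\<in>B l. \<Sum>k\<in>{1..N}. cbar j k t * s j k t)"

definition s_feasible ::
  "(nat \<Rightarrow> nat \<Rightarrow> nat \<Rightarrow> real) \<Rightarrow> ('b \<Rightarrow> nat \<Rightarrow> nat \<Rightarrow> real) \<Rightarrow> bool" where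
  "s_feasible lam s \<longleftrightarrow> s \<in> s_box \<and>
     (\<forall>k\<in>{1..N}. \<forall>(t1, t2)\<in>neg_blocks k.
        lam k t1 t2 \<ge> 1 / real (t2 - t1) * (\<Sum>j\<in>batteries. \<Sum>t\<in>{t1 + 1..t2}. s j k t))"

definition minimizers ::
  "(nat \<Rightarrow> nat \<Rightarrow> nat \<Rightarrow> real) \<Rightarrow> ('b \<Rightarrow> nat \<Rightarrow> nat \<Rightarrow> real) set" where
  "minimizers lam = {s. is_arg_min s_cost (s_feasible lam) s}"

definition proj_ys :: "((nat \<Rightarrow> nat \<Rightarrow> real) \<times> ('b \<Rightarrow> nat \<Rightarrow> nat \<Rightarrow> real)) set" where
  "proj_ys = {(y, s). \<exists>lam. (y, lam) \<in> P_ylam \<and> s \<in> minimizers lam}"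

text \<open>
  The strict inclusion of \<open>proj_ys\<close> in \<open>P_ys\<close> does not hold for all data admitted by the locale.
  If the smallest reduced cost of some port and period is exactly 0, minimizers may charge
  arbitrarily many batteries there (e.g. \<open>N = T = L = 1\<close>, two batteries, \<open>cbar = 0\<close>: no block is
  negative, every \<open>s\<close> in the box is a minimizer, and \<open>P_ys\<close> forbids charging both). If \<open>T = 1\<close>
  (e.g. with one battery of negative cost), or if no battery has the full window \<open>{1..T}\<close>
  (e.g. no batteries at all), the two sets can be equal. The theorem on the strict inclusion
  therefore assumes that \<open>2 \<le> T\<close>, that \<open>B L\<close> is not empty, and that these smallest reduced
  costs are not 0.
\<close>

end

end

theory Submission
  imports Defs
begin

text \<open>
  Only the blocks of length one matter. If the block \<open>(t - 1, t)\<close> of port \<open>k\<close> is negative, then the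
  coupling constraint bounds the total charge of \<open>k\<close> in period \<open>t\<close> by \<open>lam k (t - 1) t\<close>, which is at
  most 1, at most \<open>y k (t - 1)\<close> and at most \<open>y k t\<close>. Otherwise all reduced costs of \<open>k\<close> in period
  \<open>t\<close> are positive, and a minimizer charges nothing there. All constraints of the original
  relaxation follow. For strictness, keep one battery with full window charging on one port in
  all periods, with \<open>y = 0\<close>: in the projection, \<open>y\<close> would have to dominate the charge in period 1.
\<close>

context battery_charging
begin

lemma finite_batteries: "finite batteries"
  using finite_B by (auto simp: batteries_def)

lemma s_box_nonneg:
  assumes "s \<in> s_box"
  shows "0 \<le> s j k t"
proof (cases "(j, k, t) \<in> s_index")
  case True
  then show ?thesis using assms unfolding s_box_def by fastforce
next
  case False
  then show ?thesis using assms unfolding s_box_def by auto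
qed

lemma s_le_sum_batteries:
  assumes "s \<in> s_box" "l \<in> {1..L}" "j \<in> B l"
  shows "s j k t \<le> (\<Sum>j\<in>batteries. s j k t)"
proof (rule member_le_sum)
  show "j \<in> batteries"
    using assms by (auto simp: batteries_def)
qed (use assms(1) finite_batteries s_box_nonneg in auto)

text \<open>A single sum over a finite index set lets one strictly smaller summand make the whole
  cost strictly smaller.\<close>

lemma s_cost_Sigma:
  "s_cost s = (\<Sum>(l, t, j, k)\<in>(SIGMA l:{1..L}. {1..n l} \<times> B l \<times> {1..N}). cbar j k t * s j k t)"
proof -
  have "(\<Sum>t\<in>{1..n l}. \<Sum>j\<in>B l. \<Sum>k\<in>{1..N}. cbar j k t * s j k t) =
        (\<Sum>(t, j, k)\<in>{1..n l} \<times> B l \<times> {1..N}. cbar j k t * s j k t)" for l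
    by (simp add: sum.cartesian_product)
  then show ?thesis
    using finite_B by (simp add: s_cost_def sum.Sigma)
qed

text \<open>The coupling constraints bound sums of entries of \<open>s\<close> from above with
  nonnegative weights, so lowering entries within the box cannot violate them.\<close>

lemma s_feasible_mono:
  assumes "s_feasible lam s" "s' \<in> s_box" "\<And>j k t. s' j k t \<le> s j k t"
  shows "s_feasible lam s'"
proof -
  have "1 / real (t2 - t1) * (\<Sum>j\<in>batteries. \<Sum>t\<in>{t1 + 1..t2}. s' j k t) \<le> lam k t1 t2"
    if "k \<in> {1..N}" "(t1, t2) \<in> neg_blocks k" for k t1 t2
  proof -
    have "1 / real (t2 - t1) * (\<Sum>j\<in>batteries. \<Sum>t\<in>{t1 + 1..t2}. s' j k t) \<le>
          1 / real (t2 - t1) * (\<Sum>j\<in>batteries. \<Sum>t\<in>{t1 + 1..t2}. s j k t)"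
      by (intro mult_left_mono sum_mono assms(3)) simp
    also have "\<dots> \<le> lam k t1 t2"
      using assms(1) that unfolding s_feasible_def by blast
    finally show ?thesis .
  qed
  with assms(2) show ?thesis
    unfolding s_feasible_def by blast
qed

text \<open>A nonzero entry would be positive. Resetting it alone to 0 keeps feasibility and
  strictly lowers the cost, against minimality.\<close>

lemma minimizer_eq_0:
  assumes min: "s \<in> minimizers lam" and idx: "(j, k, t) \<in> s_index" and pos: "0 < cbar j k t"
  shows "s j k t = 0"
proof (rule ccontr)
  assume nz: "s j k t \<noteq> 0"
  have least: "\<not> s_cost s' < s_cost s" if "s_feasible lam s'" for s'
    using min that by (auto simp: minimizers_def is_arg_min_def)
  have feas: "s_feasible lam s"
    using min by (simp add: minimizers_def is_arg_min_def)
  then have box: "s \<in> s_box"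
    by (simp add: s_feasible_def)
  define s' where "s' j' k' t' = (if (j', k', t') = (j, k, t) then 0 else s j' k' t')" for j' k' t'
  have le: "s' j' k' t' \<le> s j' k' t'" for j' k' t'
    using s_box_nonneg[OF box] by (simp add: s'_def)
  have "s' \<in> s_box"
    using box unfolding s_box_def s'_def by auto
  then have feas': "s_feasible lam s'"
    using feas le by (blast intro: s_feasible_mono)
  obtain l where l: "l \<in> {1..L}" "j \<in> B l" "k \<in> {1..N}" "t \<in> {1..n l}"
    using idx by (auto simp: s_index_def)
  have "s_cost s' < s_cost s"
    unfolding s_cost_Sigma
  proof (rule sum_strict_mono_ex1)
    show "finite (SIGMA l:{1..L}. {1..n l} \<times> B l \<times> {1..N})"
      using finite_B by auto
    show "\<forall>x\<in>SIGMA l:{1..L}. {1..n l} \<times> B l \<times> {1..N}.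
        (case x of (l, t, j, k) \<Rightarrow> cbar j k t * s' j k t) \<le>
        (case x of (l, t, j, k) \<Rightarrow> cbar j k t * s j k t)"
      using pos s_box_nonneg[OF box] by (auto simp: s'_def)
    have "cbar j k t * s' j k t < cbar j k t * s j k t"
      using pos nz s_box_nonneg[OF box, of j k t] by (simp add: s'_def)
    then show "\<exists>x\<in>SIGMA l:{1..L}. {1..n l} \<times> B l \<times> {1..N}.
        (case x of (l, t, j, k) \<Rightarrow> cbar j k t * s' j k t) <
        (case x of (l, t, j, k) \<Rightarrow> cbar j k t * s j k t)"
      using l by (intro bexI[of _ "(l, t, j, k)"]) auto
  qed
  with least[OF feas'] show False by blast
qed

text \<open>Links the minimum in the nonvanishing assumption to the costs that decide membership in
  \<open>neg_blocks\<close>; \<open>1 \<le> t\<close> makes the truncated \<open>t - 1 + 1\<close>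
  equal to \<open>t\<close>.\<close>

lemma unit_block_costs:
  assumes "1 \<le> t"
  shows "block_costs k (t - 1) t = {cbar j k t | l j. l \<in> {1..L} \<and> j \<in> B l \<and> t \<le> n l}"
  using assms by (simp add: block_costs_def)

lemma finite_unit_block_costs:
  "finite {cbar j k t | l j. l \<in> {1..L} \<and> j \<in> B l \<and> t \<le> n l}"
proof (rule finite_subset)
  show "{cbar j k t | l j. l \<in> {1..L} \<and> j \<in> B l \<and> t \<le> n l} \<subseteq> (\<lambda>j. cbar j k t) ` batteries"
    unfolding batteries_def by blast
qed (simp add: finite_batteries)

lemma unit_block_dichotomy:
  assumes min: "s \<in> minimizers lam" and k: "k \<in> {1..N}" and t: "t \<in> {1..T}"
    and nz: "Min {cbar j k t | l j. l \<in> {1..L} \<and> j \<in> B l \<and> t \<le> n l} \<noteq> 0"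
  shows "(t - 1, t) \<in> neg_blocks k \<and> (\<Sum>j\<in>batteries. s j k t) \<le> lam k (t - 1) t
    \<or> (\<Sum>j\<in>batteries. s j k t) = 0"
proof (cases "(t - 1, t) \<in> neg_blocks k")
  case True
  have "s_feasible lam s"
    using min by (simp add: minimizers_def is_arg_min_def)
  \<comment> \<open>For a block of length one the divisor is 1 and the inner sum runs over the
    period \<open>t\<close> alone.\<close>
  then have "1 / real (t - (t - 1)) * (\<Sum>j\<in>batteries. \<Sum>i\<in>{t - 1 + 1..t}. s j k i) \<le> lam k (t - 1) t"
    using True k unfolding s_feasible_def by blast
  then show ?thesis
    using True t by simp
next
  case False
  have "s \<in> s_box"
    using min by (simp add: minimizers_def is_arg_min_def s_feasible_def)
  \<comment> \<open>The existence of an admissible \<open>j\<close> makes the cost set nonempty, so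
    its \<open>Min\<close> is meaningful; being neither negative nor 0, it forces every cost in the
    set to be positive.\<close>
  have "s j k t = 0" if "(j, k, t) \<in> s_index" for j
  proof -
    let ?C = "{cbar j k t | l j. l \<in> {1..L} \<and> j \<in> B l \<and> t \<le> n l}"
    have mem: "cbar j k t \<in> ?C"
      using that unfolding s_index_def by fastforce
    have "\<not> Min ?C < 0"
      using False t mem unit_block_costs[of t k] by (auto simp: neg_blocks_def)
    then have "0 < cbar j k t"
      using nz Min_le[OF finite_unit_block_costs mem] by linarith
    with min that show ?thesis
      by (rule minimizer_eq_0)
  qed
  moreover have "s j k t = 0" if "(j, k, t) \<notin> s_index" for j
    using that \<open>s \<in> s_box\<close> by (simp add: s_box_def)
  ultimately have "s j k t = 0" for j
    by blast
  then show ?thesis by simp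
qed

text \<open>\<open>lam k (t - 1) t\<close> is one nonnegative term of the sum over blocks ending at
  \<open>t\<close>, bounded by \<open>y k t\<close>, and of the sum over blocks starting at
  \<open>t - 1\<close>, bounded by \<open>y k (t - 1)\<close>. The exceptions \<open>t = T\<close>
  and \<open>t = 1\<close> are where these entries of \<open>y\<close> leave the index
  range.\<close>

lemma minimizer_charge_bounds:
  assumes P: "(y, lam) \<in> P_ylam" and min: "s \<in> minimizers lam"
    and k: "k \<in> {1..N}" and t: "t \<in> {1..T}"
    and nz: "Min {cbar j k t | l j. l \<in> {1..L} \<and> j \<in> B l \<and> t \<le> n l} \<noteq> 0"
  shows "(\<Sum>j\<in>batteries. s j k t) \<le> 1"
    and "t \<noteq> T \<Longrightarrow> (\<Sum>j\<in>batteries. s j k t) \<le> y k t"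
    and "t \<noteq> 1 \<Longrightarrow> (\<Sum>j\<in>batteries. s j k t) \<le> y k (t - 1)"
proof -
  let ?S = "\<Sum>j\<in>batteries. s j k t"
  have lam: "lam k t1 t2 \<in> {0..1}" if "(t1, t2) \<in> neg_blocks k" for t1 t2
    using P k that unfolding P_ylam_def lam_box_def by blast
  have y: "0 \<le> y k i" if "i \<in> {1..T} - {T}" for i
    using P k that unfolding P_ylam_def y_box_def by fastforce
  note dich = unit_block_dichotomy[OF min k t nz]
  show "?S \<le> 1"
    using dich lam by fastforce
  show "?S \<le> y k t" if "t \<noteq> T"
    using dich
  proof
    assume neg: "(t - 1, t) \<in> neg_blocks k \<and> ?S \<le> lam k (t - 1) t"
    then have "?S \<le> lam k (t - 1) t" by blast
    also have "\<dots> \<le> (\<Sum>i | i \<in> {0..t - 1} \<and> (i, t) \<in> neg_blocks k. lam k i t)"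
      using neg lam by (intro member_le_sum) auto
    also have "\<dots> \<le> y k t"
      using P k t that unfolding P_ylam_def by blast
    finally show ?thesis .
  qed (use y t that in auto)
  show "?S \<le> y k (t - 1)" if "t \<noteq> 1"
  proof -
    have t': "t - 1 \<in> {1..T} - {T}"
      using t that by auto
    show ?thesis
      using dich
    proof
      assume neg: "(t - 1, t) \<in> neg_blocks k \<and> ?S \<le> lam k (t - 1) t"
      then have "?S \<le> lam k (t - 1) t" by blast
      also have "\<dots> \<le> (\<Sum>i | i \<in> {t - 1 + 1..T} \<and> (t - 1, i) \<in> neg_blocks k. lam k (t - 1) i)"
        using neg lam t by (intro member_le_sum) auto
      also have "\<dots> \<le> y k (t - 1)"
        using P k t' unfolding P_ylam_def by blast
      finally show ?thesis .
    qed (use y[OF t'] in simp)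
  qed
qed

text \<open>Each difference constraint is proved by dropping its nonnegative subtrahend:
  \<open>y k t\<close> already dominates the total charge in period \<open>t + 1\<close> and,
  through the total, each battery's charge in period \<open>t\<close>.\<close>

lemma proj_ys_subset_P_ys:
  assumes nz: "\<And>k t. k \<in> {1..N} \<Longrightarrow> t \<in> {1..T} \<Longrightarrow>
    Min {cbar j k t | l j. l \<in> {1..L} \<and> j \<in> B l \<and> t \<le> n l} \<noteq> 0"
  shows "proj_ys \<subseteq> P_ys"
proof clarify
  fix y s
  assume "(y, s) \<in> proj_ys"
  then obtain lam where P: "(y, lam) \<in> P_ylam" and min: "s \<in> minimizers lam"
    by (auto simp: proj_ys_def)
  have box: "s \<in> s_box"
    using min by (simp add: minimizers_def is_arg_min_def s_feasible_def)
  note bounds = minimizer_charge_bounds[OF P min _ _ nz]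
  have "(\<Sum>j\<in>batteries. s j k (t + 1)) - (\<Sum>j\<in>batteries. s j k t) \<le> y k t"
    if "k \<in> {1..N}" "t \<in> {1..T} - {T}" for k t
  proof -
    have "(\<Sum>j\<in>batteries. s j k (t + 1)) \<le> y k t"
      using bounds(3)[of k "t + 1"] that by auto
    moreover have "0 \<le> (\<Sum>j\<in>batteries. s j k t)"
      by (intro sum_nonneg s_box_nonneg box)
    ultimately show ?thesis by linarith
  qed
  moreover have "s j k t - s j k (t + 1) \<le> y k t"
    if "l \<in> {1..L}" "j \<in> B l" "k \<in> {1..N}" "t \<in> {1..n l} - {T}" for l j k t
  proof -
    have "t \<in> {1..T}" "t \<noteq> T"
      using that n_range[of l] by auto
    then have "s j k t \<le> y k t"
      using s_le_sum_batteries[OF box that(1,2), of k t] bounds(2)[of k t] that(3) by fastforce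
    then show ?thesis
      using s_box_nonneg[OF box, of j k "t + 1"] by linarith
  qed
  moreover have "y \<in> y_box" "\<forall>t\<in>{1..T} - {T}. (\<Sum>k\<in>{1..N}. y k t) \<le> real \<gamma>"
    using P by (auto simp: P_ylam_def)
  ultimately show "(y, s) \<in> P_ys"
    using box bounds(1) by (simp add: P_ys_def)
qed

text \<open>Constant charging never rises or falls between consecutive periods, so
  \<open>y = 0\<close> satisfies the difference constraints. A battery of \<open>B L\<close> may
  charge in all periods because \<open>n L = T\<close>.\<close>

lemma constant_charging_in_P_ys:
  assumes "j0 \<in> B L" "k0 \<in> {1..N}"
  shows "(\<lambda>_ _. 0, \<lambda>j k t. if j = j0 \<and> k = k0 \<and> t \<in> {1..T} then 1 else 0) \<in> P_ys"
    (is "(_, ?s) \<in> _")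
proof -
  have j0: "j0 \<in> batteries"
    using assms L_pos by (auto simp: batteries_def)
  have sum: "(\<Sum>j\<in>batteries. ?s j k t) = (if k = k0 \<and> t \<in> {1..T} then 1 else 0)" for k t
  proof (cases "k = k0 \<and> t \<in> {1..T}")
    case True
    then have "(\<Sum>j\<in>batteries. ?s j k t) = (\<Sum>j\<in>batteries. if j = j0 then 1 else 0)"
      by (intro sum.cong) auto
    with True show ?thesis
      using j0 finite_batteries by simp
  qed (auto intro: sum.neutral)
  have "(j0, k0, t) \<in> s_index" if "t \<in> {1..T}" for t
    using assms that L_pos n_last unfolding s_index_def by force
  then have "?s \<in> s_box"
    by (auto simp: s_box_def)
  \<comment> \<open>Here \<open>t < T\<close>, so period \<open>t + 1\<close> is still within the
    charging range; the final drop after period \<open>T\<close> is never tested.\<close>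
  moreover have "?s j k t - ?s j k (t + 1) \<le> 0" if "l \<in> {1..L}" "t \<in> {1..n l} - {T}" for l j k t
    using that n_range[OF that(1)] by auto
  ultimately show ?thesis
    unfolding P_ys_def mem_Collect_eq case_prod_conv sum by (auto simp: y_box_def)
qed

end

theorem proposition4p6:
  fixes N T L :: nat and B :: "nat \<Rightarrow> 'b set" and n :: "nat \<Rightarrow> nat" and c :: "nat \<Rightarrow> real"
    and \<gamma> :: nat and \<beta> :: real and \<mu> :: "'b \<Rightarrow> nat \<Rightarrow> nat \<Rightarrow> real"
  assumes "battery_charging N T L B n c \<beta>"
    and "2 \<le> T" and "B L \<noteq> {}"
    and "\<And>k t. k \<in> {1..N} \<Longrightarrow> t \<in> {1..T} \<Longrightarrow>
      Min {battery_charging.cbar c \<beta> \<mu> j k t | l j. l \<in> {1..L} \<and> j \<in> B l \<and> t \<le> n l} \<noteq> 0"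
  shows "battery_charging.proj_ys N T L B n c \<gamma> \<beta> \<mu> \<subset> battery_charging.P_ys N T L B n \<gamma>"
proof -
  interpret battery_charging N T L B n c \<gamma> \<beta> \<mu>
    by fact
  obtain j0 where j0: "j0 \<in> B L"
    using assms(3) by blast
  have k: "1 \<in> {1..N}" and t: "1 \<in> {1..T}" and L: "L \<in> {1..L}"
    using N_pos T_pos L_pos by auto
  let ?y = "\<lambda>(_ :: nat) (_ :: nat). 0 :: real"
  let ?s = "\<lambda>j (k :: nat) t. if j = j0 \<and> k = 1 \<and> t \<in> {1..T} then 1 else 0 :: real"
  have "(?y, ?s) \<notin> proj_ys"
  proof
    assume "(?y, ?s) \<in> proj_ys"
    then obtain lam where P: "(?y, lam) \<in> P_ylam" and min: "?s \<in> minimizers lam"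
      by (auto simp: proj_ys_def)
    have "?s \<in> s_box"
      using min by (simp add: minimizers_def is_arg_min_def s_feasible_def)
    then have "?s j0 1 1 \<le> (\<Sum>j\<in>batteries. ?s j 1 1)"
      using s_le_sum_batteries[of ?s, OF _ L j0] by blast
    \<comment> \<open>Since \<open>2 \<le> T\<close>, period 1 is not the last one, so the total
      charge in it is at most \<open>?y 1 1 = 0\<close>.\<close>
    also have "\<dots> \<le> 0"
      using minimizer_charge_bounds(2)[OF P min k t assms(4)[OF k t]] assms(2) by simp
    finally show False
      using t by simp
  qed
  moreover have "(?y, ?s) \<in> P_ys"
    using j0 k by (rule constant_charging_in_P_ys)
  moreover have "proj_ys \<subseteq> P_ys"
    using assms(4) by (rule proj_ys_subset_P_ys)
  ultimately show ?thesis
    by blast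
qed

end
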